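(* For any weak $(n,m,a,\rho)$-AMD code $(S,G,\mathcal{A},E_u)$, we have $$\rho\ \geq\ \rho_{(n,m,a)}\ \geq\ \min_{K}\left\{\left\lceil\frac{\widetilde{k}a(m-1)}{n-1}\right\rceil\frac{1}{\widetilde{k}m}\,:\,\sum_{1\leq i\leq m}k_i=a\right\},$$ where the minimum is over all tuples $K=(k_1,\dots,k_m)$ of positive integers (the possible values of the sizes of the sets in $\mathcal{A}$) with $\sum_{i}k_i=a$, and $\widetilde{k}=\mathrm{lcm}(k_1,\dots,k_m)$.
   Context: All groups are written additively with identity $0$. Weak AMD code: let $S$ be a set of $m$ source messages, $G$ an Abelian group of order $n$, and $\mathcal{A}=\{A_s : s\in S\}$ a family of pairwise disjoint nonempty subsets of $G$. A source $s\in S$ is chosen uniformly at random, and $E_u$ encodes $s$ as a uniformly random $g\in A_s$. The adversary, with no knowledge of $s$ or $g$, chooses $\Delta\in G\setminus\{0\}$ and wins if $g+\Delta\in A_{s'}$ for some $s'\neq s$. Let $\rho_\Delta$ be the probability of winning with $\Delta$, i.e. $\rho_\Delta=\frac1m\sum_{s\in S}\frac{1}{|A_s|}\,|\{g\in A_s : g+\Delta\in\bigcup_{s'\ne s}A_{s'}\}|$. Then $(S,G,\mathcal{A},E_u)$ is a weak $(n,m,a,\rho)$-AMD code, where $a=\sum_{s\in S}|A_s|$ and $\rho=\max\{\rho_\Delta : \Delta\in G\setminus\{0\}\}$. BSWEDF: for multi-sets $B_1,B_2$ of elements of $G$, $D(B_1,B_2)$ is the multi-set $\{x-y : x\in B_1,\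 y\in B_2\}$; $k\boxtimes B$ is the multi-set in which each element of $B$ is repeated $k$ times; unions are multi-set unions. Let $\mathcal{B}=\{B_i : 1\le i\le m\}$ be a family of pairwise disjoint nonempty subsets of $G$, $k_i=|B_i|$, $K=(k_1,\dots,k_m)$, $a=\sum_i k_i$, $\widetilde{k}=\mathrm{lcm}(k_1,\dots,k_m)$, $\widetilde{B}_i=\frac{\widetilde{k}}{k_i}\boxtimes B_i$. Then $\mathcal{B}$ is an $(n,m,K,a,\lambda)$-BSWEDF (bounded standard weighted external difference family) if $\lambda$ is the smallest positive integer such that $\bigcup_{1\le i\ne j\le m}D(B_i,\widetilde{B}_j)\subseteq\lambda\boxtimes(G\setminus\{0\})$. Define $$\rho_{(n,m,a)}=\min_{K'}\left\{\frac{\lambda'}{\widetilde{k'}m} : \text{there exists an }(n,m,K',a,\lambda')\text{-BSWEDF (over an Abelian group of order } n)\text{ with }\sum_{i}k'_i=a\right\},$$ where $K'=(k'_1,\dots,k'_m)$ and $\widetilde{k'}=\mathrm{lcm}(k'_1,\dots,k'_m)$.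
   Formalization: It is assumed that m ≥ 2: for m = 1 one has ρ = 0 while λ = 1 is the smallest positive integer, so ρ_(n,1,a) = 1/a > 0 and the claim fails. The groups in ρ_(n,m,a) have natural numbers as elements, which covers all finite groups up to isomorphism. *)

theory Defs
  imports
    "HOL-Algebra.Coset"
    "HOL-Library.Multiset"
    "HOL-Library.Disjoint_Sets"
    "HOL-Probability.Probability_Mass_Function"
begin

(* Abelian groups are HOL-Algebra commutative groups. These are written
   multiplicatively: \<one> is the additive identity 0, and x \<otimes> inv y is x - y. *)

definition win_prob ::
    "'s set \<Rightarrow> ('g, 'b) monoid_scheme \<Rightarrow> ('s \<Rightarrow> 'g set) \<Rightarrow> ('s \<Rightarrow> 'g pmf) \<Rightarrow> 'g \<Rightarrow> real" where
  "win_prob S G A E \<Delta> =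
     measure_pmf.prob
       (bind_pmf (pmf_of_set S) (\<lambda>s. map_pmf (\<lambda>g. (s, g)) (E s)))
       {(s, g). \<exists>s'\<in>S. s' \<noteq> s \<and> g \<otimes>\<^bsub>G\<^esub> \<Delta> \<in> A s'}"

definition weak_AMD_code ::
    "'s set \<Rightarrow> ('g, 'b) monoid_scheme \<Rightarrow> ('s \<Rightarrow> 'g set) \<Rightarrow> ('s \<Rightarrow> 'g pmf) \<Rightarrow>
     nat \<Rightarrow> nat \<Rightarrow> nat \<Rightarrow> real \<Rightarrow> bool" where
  "weak_AMD_code S G A E n m a \<rho> \<longleftrightarrow>
     finite S \<and> card S = m \<and>
     comm_group G \<and> finite (carrier G) \<and> Coset.order G = n \<and>
     (\<forall>s\<in>S. A s \<subseteq> carrier G \<and> A s \<noteq> {}) \<and> disjoint_family_on A S \<and>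
     (\<forall>s\<in>S. E s = pmf_of_set (A s)) \<and>
     a = (\<Sum>s\<in>S. card (A s)) \<and>
     \<rho> = Max (win_prob S G A E ` (carrier G - {\<one>\<^bsub>G\<^esub>}))"

lemma win_prob_eq:
  assumes S: "finite S" "S \<noteq> {}"
    and A: "\<And>s. s \<in> S \<Longrightarrow> finite (A s) \<and> A s \<noteq> {}"
    and E: "\<And>s. s \<in> S \<Longrightarrow> E s = pmf_of_set (A s)"
  shows "win_prob S G A E \<Delta> =
     1 / real (card S) * (\<Sum>s\<in>S. 1 / real (card (A s)) *
       real (card {g \<in> A s. g \<otimes>\<^bsub>G\<^esub> \<Delta> \<in> (\<Union>s'\<in>S - {s}. A s')}))"
proof -
  let ?W = "{(s, g). \<exists>s'\<in>S. s' \<noteq> s \<and> g \<otimes>\<^bsub>G\<^esub> \<Delta> \<in> A s'}"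
  have "ennreal (win_prob S G A E \<Delta>) =
      emeasure (measure_pmf (bind_pmf (pmf_of_set S) (\<lambda>s. map_pmf (\<lambda>g. (s, g)) (E s)))) ?W"
    by (simp add: win_prob_def measure_pmf.emeasure_eq_measure)
  also have "\<dots> = (\<integral>\<^sup>+ s. ennreal (measure_pmf.prob (map_pmf (\<lambda>g. (s, g)) (E s)) ?W)
      \<partial>measure_pmf (pmf_of_set S))"
    by (subst emeasure_bind_pmf) (simp only: measure_pmf.emeasure_eq_measure)
  also have "\<dots> = ennreal (measure_pmf.expectation (pmf_of_set S)
      (\<lambda>s. measure_pmf.prob (map_pmf (\<lambda>g. (s, g)) (E s)) ?W))"
    by (rule nn_integral_eq_integral) (simp_all add: integrable_measure_pmf_finite S)
  finally have "win_prob S G A E \<Delta> = measure_pmf.expectation (pmf_of_set S)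
      (\<lambda>s. measure_pmf.prob (map_pmf (\<lambda>g. (s, g)) (E s)) ?W)"
    by (subst (asm) ennreal_inj) (simp_all add: win_prob_def del: measure_map_pmf)
  also have "\<dots> = (\<Sum>s\<in>S. measure_pmf.prob (map_pmf (\<lambda>g. (s, g)) (E s)) ?W) / card S"
    by (rule integral_pmf_of_set) (use S in auto)
  also have "(\<Sum>s\<in>S. measure_pmf.prob (map_pmf (\<lambda>g. (s, g)) (E s)) ?W) =
      (\<Sum>s\<in>S. 1 / real (card (A s)) *
       real (card {g \<in> A s. g \<otimes>\<^bsub>G\<^esub> \<Delta> \<in> (\<Union>s'\<in>S - {s}. A s')}))"
  proof (rule sum.cong[OF refl])
    fix s assume s: "s \<in> S"
    have "A s \<inter> (\<lambda>g. (s, g)) -` ?W = {g \<in> A s. g \<otimes>\<^bsub>G\<^esub> \<Delta> \<in> (\<Union>s'\<in>S - {s}. A s')}"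
      by auto
    then show "measure_pmf.prob (map_pmf (\<lambda>g. (s, g)) (E s)) ?W =
        1 / real (card (A s)) *
        real (card {g \<in> A s. g \<otimes>\<^bsub>G\<^esub> \<Delta> \<in> (\<Union>s'\<in>S - {s}. A s')})"
      using A[OF s] by (simp add: E[OF s] measure_pmf_of_set del: UN_iff)
  qed
  finally show ?thesis by simp
qed

definition diff_mset ::
    "('g, 'b) monoid_scheme \<Rightarrow> 'g multiset \<Rightarrow> 'g multiset \<Rightarrow> 'g multiset" where
  "diff_mset G B1 B2 = (\<Sum>x\<in>#B1. {# x \<otimes>\<^bsub>G\<^esub> inv\<^bsub>G\<^esub> y. y \<in># B2 #})"

definition ktilde :: "nat \<Rightarrow> (nat \<Rightarrow> nat) \<Rightarrow> nat" where
  "ktilde m K = (LCM i\<in>{1..m}. K i)"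

definition Btilde :: "nat \<Rightarrow> (nat \<Rightarrow> 'g set) \<Rightarrow> nat \<Rightarrow> 'g multiset" where
  "Btilde m B i =
     repeat_mset (ktilde m (\<lambda>j. card (B j)) div card (B i)) (mset_set (B i))"

(* The multi-set union adds multiplicities (it is not the maximum), hence a sum. *)
definition external_diffs ::
    "('g, 'b) monoid_scheme \<Rightarrow> nat \<Rightarrow> (nat \<Rightarrow> 'g set) \<Rightarrow> 'g multiset" where
  "external_diffs G m B =
     (\<Sum>(i, j) \<in> {(i, j). i \<in> {1..m} \<and> j \<in> {1..m} \<and> i \<noteq> j}.
        diff_mset G (mset_set (B i)) (Btilde m B j))"

(* A tuple (k_1, ..., k_m) is a function on nat of which only the values on {1..m} matter. *)
definition BSWEDF ::
    "('g, 'b) monoid_scheme \<Rightarrow> (nat \<Rightarrow> 'g set) \<Rightarrow>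
     nat \<Rightarrow> nat \<Rightarrow> (nat \<Rightarrow> nat) \<Rightarrow> nat \<Rightarrow> nat \<Rightarrow> bool" where
  "BSWEDF G B n m K a l \<longleftrightarrow>
     comm_group G \<and> finite (carrier G) \<and> Coset.order G = n \<and>
     (\<forall>i\<in>{1..m}. B i \<subseteq> carrier G \<and> B i \<noteq> {}) \<and> disjoint_family_on B {1..m} \<and>
     (\<forall>i\<in>{1..m}. K i = card (B i)) \<and> a = (\<Sum>i\<in>{1..m}. K i) \<and>
     is_arg_min (\<lambda>l. l)
       (\<lambda>l. l > 0 \<and>
         external_diffs G m B \<subseteq># repeat_mset l (mset_set (carrier G - {\<one>\<^bsub>G\<^esub>}))) l"

(* Every group of finite order n is isomorphic to one whose carrier is a set of naturals,
   and being a BSWEDF is invariant under isomorphism, so letting G' range over nat monoids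
   covers all Abelian groups of order n. The values that are minimised form a finite set. *)
definition rho_opt :: "nat \<Rightarrow> nat \<Rightarrow> nat \<Rightarrow> real" where
  "rho_opt n m a =
     Min {real l' / (real (ktilde m K') * real m) | l' K'.
            \<exists>(G' :: nat monoid) B'. BSWEDF G' B' n m K' a l' \<and> (\<Sum>i\<in>{1..m}. K' i) = a}"

end

theory Submission
  imports Defs
begin

text \<open>
  For a fixed \<open>\<Delta>\<close>, the multiplicity of \<open>\<Delta>\<close> among the external differences
  of \<open>(A_s)\<close>, where \<open>A_s\<close> is weighted by \<open>k / |A_s|\<close> with \<open>k\<close> the least common multiple
  of the sizes, is \<open>k m\<close> times the winning probability of \<open>\<Delta>\<close>. Maximising over
  \<open>\<Delta> \<noteq> 0\<close>, every weak AMD code is a BSWEDF whose parameter \<open>\<lambda>\<close> satisfies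
  \<open>\<rho> = \<lambda> / (k m)\<close>. For the second bound, there are \<open>k a (m - 1)\<close> external differences in
  total, spread over \<open>n - 1\<close> nonzero elements with multiplicity at most \<open>\<lambda>\<close> each.
\<close>

section \<open>Multiplicities in difference multisets\<close>

lemma count_repeat_image_mset_set:
  assumes "finite Y"
  shows "count (image_mset f (repeat_mset r (mset_set Y))) d = r * card {y \<in> Y. f y = d}"
proof -
  have "image_mset f (repeat_mset r (mset_set Y)) = repeat_mset r (image_mset f (mset_set Y))"
    by (induction r) auto
  moreover have "{y \<in> Y. d = f y} = {y \<in> Y. f y = d}" by auto
  ultimately show ?thesis
    using assms by (simp add: count_image_mset' sum.If_cases Int_def)
qed

text \<open>The equation \<open>x \<otimes> inv y = d\<close> means
  \<open>x = d \<otimes> y\<close>, so each \<open>y\<close> pairs with at most one \<open>x\<close>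
  and the pairs can be counted by \<open>y\<close> alone.\<close>

lemma (in group) count_diff_mset:
  assumes X: "finite X" "X \<subseteq> carrier G" and Y: "finite Y" "Y \<subseteq> carrier G"
    and d: "d \<in> carrier G"
  shows "count (diff_mset G (mset_set X) (repeat_mset r (mset_set Y))) d =
    r * card {y \<in> Y. d \<otimes> y \<in> X}"
proof -
  have "count (diff_mset G (mset_set X) (repeat_mset r (mset_set Y))) d =
      (\<Sum>x\<in>X. r * card {y \<in> Y. x \<otimes> inv y = d})"
    unfolding diff_mset_def sum_unfold_sum_mset[symmetric] count_sum
    using Y by (simp add: count_repeat_image_mset_set)
  also have "\<dots> = r * (\<Sum>x\<in>X. card {y \<in> Y. x \<otimes> inv y = d})"
    by (simp add: sum_distrib_left)
  also have "(\<Sum>x\<in>X. card {y \<in> Y. x \<otimes> inv y = d}) = (\<Sum>x\<in>X. card {y \<in> Y. x = d \<otimes> y})"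
    using X Y d by (intro sum.cong refl arg_cong[where f = card] Collect_cong)
      (metis inv_solve_right' subsetD)
  also have "\<dots> = card (\<Union>x\<in>X. {y \<in> Y. x = d \<otimes> y})"
    using X Y by (intro card_UN_disjoint[symmetric]) auto
  also have "(\<Union>x\<in>X. {y \<in> Y. x = d \<otimes> y}) = {y \<in> Y. d \<otimes> y \<in> X}"
    by auto
  finally show ?thesis .
qed

section \<open>The least common multiple of the sizes\<close>

lemma ktilde_dvd:
  assumes "i \<in> {1..m}"
  shows "K i dvd ktilde m K"
  unfolding ktilde_def using assms by (intro dvd_Lcm) auto

lemma ktilde_pos:
  assumes "\<forall>i\<in>{1..m}. K i > 0"
  shows "ktilde m K > 0"
proof -
  have "0 \<notin> K ` {1..m}" using assms by (metis imageE less_irrefl)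
  then have "(LCM i\<in>{1..m}. K i) \<noteq> 0" by (subst Lcm_0_iff) auto
  then show ?thesis unfolding ktilde_def by (rule neq0_conv[THEN iffD1])
qed

text \<open>A size tuple is determined only on \<open>{1..m}\<close>; this permits replacing it by
  the actual cardinalities.\<close>

lemma ktilde_cong:
  assumes "\<And>i. i \<in> {1..m} \<Longrightarrow> K i = K' i"
  shows "ktilde m K = ktilde m K'"
  unfolding ktilde_def using assms by (intro arg_cong[where f = Lcm] image_cong) auto

text \<open>Each size lies between 1 and \<open>a\<close>, hence divides \<open>fact a\<close>. Only
  finitely many values of the lcm remain, which makes the sets under \<open>Min\<close>
  finite.\<close>

lemma ktilde_le_fact:
  assumes "\<forall>i\<in>{1..m}. K i > 0" and "(\<Sum>i\<in>{1..m}. K i) = a"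
  shows "ktilde m K \<le> fact a"
proof -
  have "ktilde m K dvd fact a"
    unfolding ktilde_def
  proof (rule Lcm_least)
    fix b assume "b \<in> K ` {1..m}"
    then obtain i where i: "i \<in> {1..m}" "b = K i" by auto
    then have "K i \<le> a" using assms(2) by (metis finite_atLeastAtMost member_le_sum zero_le)
    then show "b dvd fact a" using i assms(1) by (intro dvd_fact) (auto simp: Suc_le_eq)
  qed
  then show ?thesis by (intro dvd_imp_le) auto
qed

section \<open>Regrouping and counting external differences\<close>

text \<open>The weight in \<open>Btilde m B j\<close> depends on \<open>j\<close> only. With
  \<open>j\<close> as outer index it can be factored out, and \<open>j\<close> takes the role of the
  encoded source.\<close>

lemma external_diffs_eq:
  "external_diffs G m B =
    (\<Sum>j\<in>{1..m}. \<Sum>i\<in>{1..m} - {j}. diff_mset G (mset_set (B i)) (Btilde m B j))"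
proof -
  have "external_diffs G m B =
      (\<Sum>(j, i) \<in> Sigma {1..m} (\<lambda>j. {1..m} - {j}). diff_mset G (mset_set (B i)) (Btilde m B j))"
    unfolding external_diffs_def
    by (rule sum.reindex_bij_witness[where i = prod.swap and j = prod.swap]) auto
  then show ?thesis by (simp add: sum.Sigma)
qed

lemma size_diff_mset: "size (diff_mset G X Y) = size X * size Y"
  unfolding diff_mset_def by (induction X) auto

text \<open>Adding the omitted diagonal completes the inner sums. The truncated
  \<open>card I - 1\<close> does no harm for empty \<open>I\<close>, where both sides are 0.\<close>

lemma sum_sum_except:
  fixes k :: "'i \<Rightarrow> nat"
  assumes "finite I"
  shows "(\<Sum>j\<in>I. \<Sum>i\<in>I - {j}. k i) = (card I - 1) * (\<Sum>i\<in>I. k i)"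
proof -
  have "(\<Sum>j\<in>I. \<Sum>i\<in>I - {j}. k i) + (\<Sum>j\<in>I. k j) = (\<Sum>j\<in>I. \<Sum>i\<in>I. k i)"
    unfolding sum.distrib[symmetric]
    using assms by (intro sum.cong refl) (simp add: sum.remove)
  also have "\<dots> = card I * (\<Sum>i\<in>I. k i)" by simp
  finally show ?thesis
    by (cases "card I") (use assms in auto)
qed

section \<open>Disjoint families: multiplicities and winning probabilities\<close>

text \<open>These are the conditions shared by codes with source set \<open>{1..m}\<close> and
  BSWEDFs, so that one family can be read both ways.\<close>

locale finite_disjoint_family = comm_group G for G :: "('g, 'b) monoid_scheme" (structure) +
  fixes m :: nat and B :: "nat \<Rightarrow> 'g set"
  assumes finite_carrier: "finite (carrier G)"
    and sub: "i \<in> {1..m} \<Longrightarrow> B i \<subseteq> carrier G"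
    and nonempty: "i \<in> {1..m} \<Longrightarrow> B i \<noteq> {}"
    and disj: "disjoint_family_on B {1..m}"
begin

abbreviation kt :: nat where "kt \<equiv> ktilde m (\<lambda>i. card (B i))"
abbreviation tot :: nat where "tot \<equiv> \<Sum>i\<in>{1..m}. card (B i)"
abbreviation wins :: "'g \<Rightarrow> real" where
  "wins \<equiv> win_prob {1..m} G B (\<lambda>i. pmf_of_set (B i))"

lemma finite_B: "i \<in> {1..m} \<Longrightarrow> finite (B i)"
  using sub finite_carrier finite_subset by blast

lemma card_B_pos: "i \<in> {1..m} \<Longrightarrow> card (B i) > 0"
  using finite_B nonempty by (auto simp: card_gt_0_iff)

lemma kt_pos: "kt > 0"
  using card_B_pos by (intro ktilde_pos) auto

text \<open>The weighting gives every \<open>Btilde m B j\<close> the same size \<open>kt\<close>,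
  so the block of \<open>j\<close> contributes \<open>kt\<close> times the sum of the other
  sizes.\<close>

lemma size_external_diffs: "size (external_diffs G m B) = kt * tot * (m - 1)"
proof -
  have "size (external_diffs G m B) = (\<Sum>j\<in>{1..m}. \<Sum>i\<in>{1..m} - {j}. card (B i) * kt)"
    unfolding external_diffs_eq size_multiset_sum size_diff_mset Btilde_def
    by (intro sum.cong refl) (simp add: finite_B ktilde_dvd[where K = "\<lambda>i. card (B i)"])
  also have "\<dots> = kt * (\<Sum>j\<in>{1..m}. \<Sum>i\<in>{1..m} - {j}. card (B i))"
    by (simp add: sum_distrib_left mult.commute)
  also have "\<dots> = kt * tot * (m - 1)"
    by (simp add: sum_sum_except mult_ac)
  finally show ?thesis .
qed

text \<open>A difference \<open>x \<otimes> inv g\<close> with \<open>g\<close> in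
  \<open>B j\<close> equals \<open>d\<close> exactly when the shift \<open>d\<close> takes
  \<open>g\<close> to \<open>x\<close>. What is counted are the encodings of source \<open>j\<close>
  on which the adversary wins.\<close>

lemma count_external_diffs:
  assumes d: "d \<in> carrier G"
  shows "count (external_diffs G m B) d =
    (\<Sum>j\<in>{1..m}. kt div card (B j) * card {g \<in> B j. g \<otimes> d \<in> (\<Union>i\<in>{1..m} - {j}. B i)})"
  unfolding external_diffs_eq count_sum Btilde_def
proof (rule sum.cong[OF refl])
  fix j assume j: "j \<in> {1..m}"
  let ?r = "kt div card (B j)"
  have "(\<Sum>i\<in>{1..m} - {j}.
        count (diff_mset G (mset_set (B i)) (repeat_mset ?r (mset_set (B j)))) d) =
      (\<Sum>i\<in>{1..m} - {j}. ?r * card {g \<in> B j. g \<otimes> d \<in> B i})"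
  proof (rule sum.cong[OF refl])
    fix i assume i: "i \<in> {1..m} - {j}"
    \<comment> \<open>Commutativity enters here: the differences give \<open>d \<otimes> g\<close>,
      whereas the adversary adds the shift on the right.\<close>
    have "{g \<in> B j. d \<otimes> g \<in> B i} = {g \<in> B j. g \<otimes> d \<in> B i}"
      using d sub[OF j] m_comm by (intro Collect_cong) (metis subsetD)
    then show "count (diff_mset G (mset_set (B i)) (repeat_mset ?r (mset_set (B j)))) d =
        ?r * card {g \<in> B j. g \<otimes> d \<in> B i}"
      using i j d sub finite_B by (subst count_diff_mset) auto
  qed
  also have "\<dots> = ?r * (\<Sum>i\<in>{1..m} - {j}. card {g \<in> B j. g \<otimes> d \<in> B i})"
    by (simp add: sum_distrib_left)
  \<comment> \<open>By disjointness, \<open>g \<otimes> d\<close> lies in at most one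
    \<open>B i\<close>.\<close>
  also have "(\<Sum>i\<in>{1..m} - {j}. card {g \<in> B j. g \<otimes> d \<in> B i}) =
      card (\<Union>i\<in>{1..m} - {j}. {g \<in> B j. g \<otimes> d \<in> B i})"
    using disj finite_B[OF j]
    by (intro card_UN_disjoint[symmetric]) (auto simp: disjoint_family_on_def)
  also have "(\<Union>i\<in>{1..m} - {j}. {g \<in> B j. g \<otimes> d \<in> B i}) =
      {g \<in> B j. g \<otimes> d \<in> (\<Union>i\<in>{1..m} - {j}. B i)}"
    by auto
  finally show "(\<Sum>i\<in>{1..m} - {j}.
        count (diff_mset G (mset_set (B i)) (repeat_mset ?r (mset_set (B j)))) d) =
      ?r * card {g \<in> B j. g \<otimes> d \<in> (\<Union>i\<in>{1..m} - {j}. B i)}" .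
qed

text \<open>The factor \<open>m\<close> cancels the uniform choice of the source, and
  \<open>kt\<close> turns the probability \<open>1 / card (B j)\<close> of an encoding into its
  integral weight.\<close>

lemma count_external_diffs_eq_wins:
  assumes d: "d \<in> carrier G" and m: "m > 0"
  shows "real (count (external_diffs G m B) d) = real kt * real m * wins d"
proof -
  let ?c = "\<lambda>j. card {g \<in> B j. g \<otimes> d \<in> (\<Union>i\<in>{1..m} - {j}. B i)}"
  have "wins d = 1 / real m * (\<Sum>j\<in>{1..m}. 1 / real (card (B j)) * real (?c j))"
    using m finite_B nonempty by (subst win_prob_eq) auto
  then have "real kt * real m * wins d =
      (\<Sum>j\<in>{1..m}. real kt / real (card (B j)) * real (?c j))"
    using m by (simp add: sum_distrib_left)
  \<comment> \<open>The division is exact because \<open>card (B j)\<close> divides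
    \<open>kt\<close>.\<close>
  also have "\<dots> = (\<Sum>j\<in>{1..m}. real (kt div card (B j) * ?c j))"
    by (intro sum.cong refl)
      (simp add: real_of_nat_div ktilde_dvd[where K = "\<lambda>i. card (B i)"])
  finally show ?thesis
    by (simp add: count_external_diffs[OF d])
qed

text \<open>Sets with different indices are disjoint, so no external difference is the
  identity.\<close>

lemma set_mset_external_diffs: "set_mset (external_diffs G m B) \<subseteq> carrier G - {\<one>}"
proof
  fix x assume "x \<in># external_diffs G m B"
  then obtain i j where ij: "j \<in> {1..m}" "i \<in> {1..m} - {j}"
    and x: "x \<in># diff_mset G (mset_set (B i)) (Btilde m B j)"
    unfolding external_diffs_eq set_mset_sum[OF finite_atLeastAtMost]
      set_mset_sum[OF finite_Diff[OF finite_atLeastAtMost]] by blast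
  from x obtain y z
    where yz: "y \<in># mset_set (B i)" "z \<in># Btilde m B j" "x = y \<otimes> inv z"
    unfolding diff_mset_def by auto
  have y: "y \<in> B i" using yz(1) finite_B ij by auto
  have z: "z \<in> B j" using yz(2) finite_B[OF ij(1)] unfolding Btilde_def
    by (simp flip: count_greater_zero_iff add: count_mset_set' split: if_splits)
  have yc: "y \<in> carrier G" and zc: "z \<in> carrier G" using y z ij sub by auto
  have "y \<noteq> z" using disj y z ij unfolding disjoint_family_on_def by blast
  then have "x \<noteq> \<one>" unfolding yz(3)
    using yc zc by (simp add: inv_solve_right')
  then show "x \<in> carrier G - {\<one>}" using yz(3) yc zc by simp
qed

lemma external_diffs_subseteq_iff:
  "external_diffs G m B \<subseteq># repeat_mset l (mset_set (carrier G - {\<one>})) \<longleftrightarrow>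
    (\<forall>d\<in>carrier G - {\<one>}. count (external_diffs G m B) d \<le> l)"
proof -
  have "count (external_diffs G m B) d = 0" if "d \<notin> carrier G - {\<one>}" for d
    using that set_mset_external_diffs by (meson count_eq_zero_iff subsetD)
  then show ?thesis
    using finite_carrier by (auto simp: subseteq_mset_def count_mset_set')
qed

lemma BSWEDF_iff:
  "BSWEDF G B n m K a l \<longleftrightarrow>
    Coset.order G = n \<and> (\<forall>i\<in>{1..m}. K i = card (B i)) \<and> a = (\<Sum>i\<in>{1..m}. K i) \<and>
    is_arg_min (\<lambda>l. l)
      (\<lambda>l. l > 0 \<and> (\<forall>d\<in>carrier G - {\<one>}. count (external_diffs G m B) d \<le> l)) l"
  unfolding BSWEDF_def external_diffs_subseteq_iff
  using finite_carrier sub nonempty disj comm_group_axioms by auto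

lemma tot_pos:
  assumes "m > 0"
  shows "tot > 0"
  using assms card_B_pos by (intro sum_pos) auto

text \<open>Two nonempty sets already produce a difference. The witness shows that nonidentity
  elements exist and that the maximal multiplicity is positive, as the parameter of a BSWEDF must
  be.\<close>

lemma ex_count_external_diffs_pos:
  assumes m: "m \<ge> 2"
  obtains d where "d \<in> carrier G - {\<one>}" "count (external_diffs G m B) d > 0"
proof -
  have "size (external_diffs G m B) > 0"
    unfolding size_external_diffs using kt_pos tot_pos m by simp
  then obtain d where "d \<in># external_diffs G m B"
    by fastforce
  then show ?thesis using that set_mset_external_diffs by auto
qed

text \<open>The least bound on all multiplicities is their maximum; division by the positive
  constant \<open>kt * m\<close> carries it to the maximal winning probability.\<close>

lemma code_imp_BSWEDF:
  assumes m: "m \<ge> 2"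
  obtains l where "BSWEDF G B (Coset.order G) m (\<lambda>i. card (B i)) tot l"
    and "Max (wins ` (carrier G - {\<one>})) = real l / (real kt * real m)"
proof -
  let ?D = "carrier G - {\<one>}" and ?c = "count (external_diffs G m B)"
  define l where "l = Max (?c ` ?D)"
  obtain d where d: "d \<in> ?D" "?c d > 0" using ex_count_external_diffs_pos m by blast
  have fin: "finite ?D" using finite_carrier by simp
  have le: "?c e \<le> l" if "e \<in> ?D" for e
    unfolding l_def using fin that by (intro Max_ge) auto
  have "l \<in> ?c ` ?D" unfolding l_def using fin d by (intro Max_in) auto
  then obtain e where e: "e \<in> ?D" "?c e = l" by auto
  have "l > 0" using le[OF d(1)] d(2) by linarith
  \<comment> \<open>Minimality: the maximum is attained at \<open>e\<close>, so any smaller bound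
    fails there.\<close>
  then have "BSWEDF G B (Coset.order G) m (\<lambda>i. card (B i)) tot l"
    unfolding BSWEDF_iff is_arg_min_def using le e by (auto dest: leD)
  moreover have w: "wins x = real (?c x) / (real kt * real m)" if "x \<in> ?D" for x
    using that m kt_pos by (subst count_external_diffs_eq_wins) auto
  have "Max (wins ` ?D) = real l / (real kt * real m)"
  proof (rule Max_eqI)
    fix y assume "y \<in> wins ` ?D"
    then obtain x where x: "x \<in> ?D" "y = wins x" by blast
    then show "y \<le> real l / (real kt * real m)"
      unfolding x(2) w[OF x(1)] using le[OF x(1)] by (intro divide_right_mono) auto
  next
    show "real l / (real kt * real m) \<in> wins ` ?D"
      using e w by force
  qed (use fin in simp)
  ultimately show ?thesis using that by blast
qed

end

section \<open>Bounds on the parameter of a BSWEDF\<close>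

lemma BSWEDF_imp_finite_disjoint_family:
  "BSWEDF G B n m K a l \<Longrightarrow> finite_disjoint_family G m B"
  unfolding BSWEDF_def finite_disjoint_family_def finite_disjoint_family_axioms_def by auto

lemma BSWEDF_size_pos: "BSWEDF G B n m K a l \<Longrightarrow> \<forall>i\<in>{1..m}. K i > 0"
  using finite_disjoint_family.card_B_pos[OF BSWEDF_imp_finite_disjoint_family]
  by (metis BSWEDF_def)

lemma BSWEDF_size_external_diffs:
  assumes "BSWEDF G B n m K a l"
  shows "size (external_diffs G m B) = ktilde m K * a * (m - 1)"
proof -
  interpret finite_disjoint_family G m B
    using assms by (rule BSWEDF_imp_finite_disjoint_family)
  have K: "\<And>i. i \<in> {1..m} \<Longrightarrow> K i = card (B i)" and a: "a = (\<Sum>i\<in>{1..m}. K i)"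
    using assms unfolding BSWEDF_def by auto
  show ?thesis
    unfolding size_external_diffs a using ktilde_cong[OF K] K by simp
qed

text \<open>The total number of external differences is positive and bounds every multiplicity, so
  minimality of \<open>l\<close> applies to it. This crude bound serves to show finiteness.\<close>

lemma BSWEDF_upper:
  assumes B: "BSWEDF G B n m K a l" and m: "m \<ge> 2"
  shows "l \<le> ktilde m K * a * (m - 1)"
proof -
  interpret finite_disjoint_family G m B
    using B by (rule BSWEDF_imp_finite_disjoint_family)
  let ?s = "size (external_diffs G m B)"
  have c: "count (external_diffs G m B) d \<le> ?s" for d
    by (rule count_le_size)
  moreover obtain d where "count (external_diffs G m B) d > 0"
    using ex_count_external_diffs_pos m by blast
  ultimately have "?s > 0" by (metis gr0I leD)
  with c have "l \<le> ?s"
    using B unfolding BSWEDF_iff is_arg_min_def by (meson not_le)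
  then show ?thesis using BSWEDF_size_external_diffs[OF B] by simp
qed

text \<open>All external differences fit into \<open>l\<close> copies of the \<open>n - 1\<close>
  nonidentity elements; comparing sizes gives the bound.\<close>

lemma BSWEDF_lower:
  assumes B: "BSWEDF G B n m K a l"
  shows "ktilde m K * a * (m - 1) \<le> l * (n - 1)"
proof -
  interpret finite_disjoint_family G m B
    using B by (rule BSWEDF_imp_finite_disjoint_family)
  have "external_diffs G m B \<subseteq># repeat_mset l (mset_set (carrier G - {\<one>\<^bsub>G\<^esub>}))"
    using B unfolding BSWEDF_def is_arg_min_def by auto
  then have "size (external_diffs G m B) \<le> l * card (carrier G - {\<one>\<^bsub>G\<^esub>})"
    using size_mset_mono by fastforce
  also have "card (carrier G - {\<one>\<^bsub>G\<^esub>}) = n - 1"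
    using B unfolding BSWEDF_def Coset.order_def by (simp add: card_Diff_singleton)
  finally show ?thesis using BSWEDF_size_external_diffs[OF B] by simp
qed

section \<open>Transfer of codes along isomorphisms\<close>

text \<open>\<open>rho_opt\<close> ranges over groups on naturals and families indexed by
  \<open>{1..m}\<close>. Relabelling group elements by \<open>f\<close> and sources by
  \<open>b\<close> brings any code into this form; shift \<open>f d\<close> then wins with the same
  probability as \<open>d\<close> did.\<close>

lemma weak_AMD_code_transfer:
  assumes code: "weak_AMD_code S G A E n m a \<rho>" and m: "m > 0"
    and f: "f \<in> iso G H" and H: "comm_group H" and b: "bij_betw b T S"
  shows "weak_AMD_code T H (\<lambda>t. f ` A (b t)) (\<lambda>t. pmf_of_set (f ` A (b t))) n m a \<rho>"
proof -
  have S: "finite S" "card S = m"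
    and G: "comm_group G" "finite (carrier G)" "Coset.order G = n"
    and A: "\<And>s. s \<in> S \<Longrightarrow> A s \<subseteq> carrier G" "\<And>s. s \<in> S \<Longrightarrow> A s \<noteq> {}"
    and disj: "disjoint_family_on A S"
    and E: "\<And>s. s \<in> S \<Longrightarrow> E s = pmf_of_set (A s)"
    and a: "a = (\<Sum>s\<in>S. card (A s))"
    and \<rho>: "\<rho> = Max (win_prob S G A E ` (carrier G - {\<one>\<^bsub>G\<^esub>}))"
    using code unfolding weak_AMD_code_def by auto
  let ?A = "\<lambda>t. f ` A (b t)"
  interpret G: comm_group G by fact
  interpret H: comm_group H by fact
  have hom: "f \<in> hom G H" and bij: "bij_betw f (carrier G) (carrier H)"
    using f by (auto simp: iso_def)
  have inj: "inj_on f (carrier G)" and img: "f ` carrier G = carrier H"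
    using bij by (auto simp: bij_betw_def)
  have bS: "b t \<in> S" if "t \<in> T" for t using b that by (auto simp: bij_betw_def)
  have T: "finite T" "card T = m" "T \<noteq> {}"
    using b S m bij_betw_finite bij_betw_same_card by (force, force, fastforce)
  have f_one: "f \<one>\<^bsub>G\<^esub> = \<one>\<^bsub>H\<^esub>"
    using hom_one[OF hom G.is_group H.is_group] .
  have card_A: "card (f ` X) = card X" if "X \<subseteq> carrier G" for X
    using inj that by (meson card_image inj_on_subset)
  have finA: "finite (A s)" if "s \<in> S" for s
    using A(1)[OF that] G(2) finite_subset by blast
  have wp: "win_prob T H ?A (\<lambda>t. pmf_of_set (?A t)) (f d) = win_prob S G A E d"
    if d: "d \<in> carrier G" for d
  proof -
    have "win_prob T H ?A (\<lambda>t. pmf_of_set (?A t)) (f d) =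
        1 / real m * (\<Sum>t\<in>T. 1 / real (card (?A t)) *
          real (card {g \<in> ?A t. g \<otimes>\<^bsub>H\<^esub> f d \<in> (\<Union>t'\<in>T - {t}. ?A t')}))"
      using T bS finA A(2) by (subst win_prob_eq) auto
    also have "(\<Sum>t\<in>T. 1 / real (card (?A t)) *
          real (card {g \<in> ?A t. g \<otimes>\<^bsub>H\<^esub> f d \<in> (\<Union>t'\<in>T - {t}. ?A t')})) =
        (\<Sum>t\<in>T. 1 / real (card (A (b t))) *
          real (card {g \<in> A (b t). g \<otimes>\<^bsub>G\<^esub> d \<in> (\<Union>s'\<in>S - {b t}. A s')}))"
    proof (rule sum.cong[OF refl])
      fix t assume t: "t \<in> T"
      let ?Y = "\<Union>s'\<in>S - {b t}. A s'"
      \<comment> \<open>The sources other than \<open>t\<close> correspond to those other than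
        \<open>b t\<close>, so the winning region in \<open>H\<close> is the image of
        \<open>?Y\<close>.\<close>
      have "b ` (T - {t}) = S - {b t}"
        using b t unfolding bij_betw_def by (auto simp: inj_on_def)
      then have "(\<Union>t'\<in>T - {t}. ?A t') = f ` ?Y"
        by (subst image_UN) (metis (no_types) image_image)
      then have "{g \<in> ?A t. g \<otimes>\<^bsub>H\<^esub> f d \<in> (\<Union>t'\<in>T - {t}. ?A t')} =
          f ` {g \<in> A (b t). f g \<otimes>\<^bsub>H\<^esub> f d \<in> f ` ?Y}"
        by (simp only:) blast
      \<comment> \<open>Since \<open>f\<close> is a homomorphism and injective on the carrier,
        membership in the image of \<open>?Y\<close> pulls back to \<open>G\<close>.\<close>
      also have "{g \<in> A (b t). f g \<otimes>\<^bsub>H\<^esub> f d \<in> f ` ?Y} = {g \<in> A (b t). g \<otimes>\<^bsub>G\<^esub> d \<in> ?Y}"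
      proof (intro Collect_cong conj_cong refl)
        fix g assume "g \<in> A (b t)"
        then have g: "g \<in> carrier G" using A bS t by blast
        have "f g \<otimes>\<^bsub>H\<^esub> f d = f (g \<otimes>\<^bsub>G\<^esub> d)" using hom g d by (simp add: hom_mult)
        moreover have "?Y \<subseteq> carrier G" using A(1) by blast
        ultimately show "f g \<otimes>\<^bsub>H\<^esub> f d \<in> f ` ?Y \<longleftrightarrow> g \<otimes>\<^bsub>G\<^esub> d \<in> ?Y"
          using inj_on_image_mem_iff[OF inj, of "g \<otimes>\<^bsub>G\<^esub> d" ?Y] g d by simp
      qed
      finally have "{g \<in> ?A t. g \<otimes>\<^bsub>H\<^esub> f d \<in> (\<Union>t'\<in>T - {t}. ?A t')} =
          f ` {g \<in> A (b t). g \<otimes>\<^bsub>G\<^esub> d \<in> ?Y}" .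
      moreover have "A (b t) \<subseteq> carrier G" using A bS t by blast
      ultimately show "1 / real (card (?A t)) *
          real (card {g \<in> ?A t. g \<otimes>\<^bsub>H\<^esub> f d \<in> (\<Union>t'\<in>T - {t}. ?A t')}) =
          1 / real (card (A (b t))) * real (card {g \<in> A (b t). g \<otimes>\<^bsub>G\<^esub> d \<in> ?Y})"
        by (simp add: card_A Collect_restrict subset_trans[OF Collect_restrict])
    qed
    also have "\<dots> = (\<Sum>s\<in>S. 1 / real (card (A s)) *
          real (card {g \<in> A s. g \<otimes>\<^bsub>G\<^esub> d \<in> (\<Union>s'\<in>S - {s}. A s')}))"
      by (rule sum.reindex_bij_betw[OF b])
    also have "1 / real m * \<dots> = win_prob S G A E d"
      using S m finA A(2) E by (subst win_prob_eq) auto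
    finally show ?thesis .
  qed
  have "carrier H - {\<one>\<^bsub>H\<^esub>} = f ` (carrier G - {\<one>\<^bsub>G\<^esub>})"
    using inj img f_one by (simp add: inj_on_image_set_diff[of f "carrier G"])
  then have "win_prob T H ?A (\<lambda>t. pmf_of_set (?A t)) ` (carrier H - {\<one>\<^bsub>H\<^esub>}) =
      win_prob S G A E ` (carrier G - {\<one>\<^bsub>G\<^esub>})"
    using wp by (auto simp: image_image intro!: image_cong)
  moreover have "disjoint_family_on ?A T"
    unfolding disjoint_family_on_def
  proof (intro ballI impI)
    fix t t' assume t: "t \<in> T" "t' \<in> T" "t \<noteq> t'"
    then have "b t \<noteq> b t'" using b by (auto simp: bij_betw_def inj_on_def)
    then have "A (b t) \<inter> A (b t') = {}"
      using disj t bS by (auto simp: disjoint_family_on_def)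
    then show "?A t \<inter> ?A t' = {}"
      using inj_on_image_Int[OF inj, of "A (b t)" "A (b t')"] A(1) bS t by auto
  qed
  moreover have "(\<Sum>t\<in>T. card (?A t)) = a"
    using sum.reindex_bij_betw[OF b, of "\<lambda>s. card (A s)"] A(1) bS a by (simp add: card_A)
  moreover have "Coset.order H = n" "finite (carrier H)"
    using G bij bij_betw_same_card[OF bij] bij_betw_finite[OF bij]
    by (auto simp: Coset.order_def)
  moreover have "?A t \<subseteq> carrier H \<and> ?A t \<noteq> {}" if "t \<in> T" for t
    using A[OF bS[OF that]] img by (metis image_is_empty image_mono)
  ultimately show ?thesis
    unfolding weak_AMD_code_def using T H \<rho> by simp
qed

text \<open>Transport of structure: a finite carrier embeds into the naturals, and the image
  receives the operation that makes the embedding a homomorphism.\<close>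

lemma (in comm_group) ex_iso_nat_monoid:
  assumes "finite (carrier G)"
  obtains H :: "nat monoid" and f where "f \<in> iso G H" "comm_group H"
proof -
  obtain f :: "_ \<Rightarrow> nat" where f: "inj_on f (carrier G)"
    using finite_imp_inj_to_nat_seg[OF assms] by blast
  define H where "H = \<lparr>carrier = f ` carrier G,
    monoid.mult = (\<lambda>x y. f (inv_into (carrier G) f x \<otimes> inv_into (carrier G) f y)), one = f \<one>\<rparr>"
  have iso: "f \<in> iso G H"
    using f by (auto simp: iso_def hom_def H_def bij_betw_def)
  moreover have "comm_group H"
    using iso_imp_img_comm_group[OF iso] by (simp add: H_def)
  ultimately show ?thesis using that by blast
qed

section \<open>Finiteness of the minimised sets and the two inequalities\<close>

lemma finite_bounded_ratios:
  fixes F :: "nat \<Rightarrow> nat \<Rightarrow> real"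
  assumes "\<And>x. x \<in> X \<Longrightarrow> \<exists>l\<le>M. \<exists>k\<le>N. x = F l k"
  shows "finite X"
proof (rule finite_subset)
  show "X \<subseteq> (\<lambda>(l, k). F l k) ` ({..M} \<times> {..N})"
    using assms by force
qed simp

theorem corollary1:
  fixes S :: "'s set"
    and G :: "('g, 'b) monoid_scheme"
    and A :: "'s \<Rightarrow> 'g set"
    and E\<^sub>u :: "'s \<Rightarrow> 'g pmf"
    and n m a :: nat
    and \<rho> :: real
  assumes "weak_AMD_code S G A E\<^sub>u n m a \<rho>"
    and "m \<ge> 2"
  shows "\<rho> \<ge> rho_opt n m a \<and>
    rho_opt n m a \<ge>
      Min {real_of_int \<lceil>real (ktilde m K) * real a * (real m - 1) / (real n - 1)\<rceil> *
             (1 / (real (ktilde m K) * real m)) | K.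
           (\<forall>i\<in>{1..m}. K i > 0) \<and> (\<Sum>i\<in>{1..m}. K i) = a}"
proof
  let ?R = "{real l' / (real (ktilde m K') * real m) | l' K'.
    \<exists>(G' :: nat monoid) B'. BSWEDF G' B' n m K' a l' \<and> (\<Sum>i\<in>{1..m}. K' i) = a}"
  let ?v = "\<lambda>k. real_of_int \<lceil>real k * real a * (real m - 1) / (real n - 1)\<rceil> *
    (1 / (real k * real m))"
  let ?V = "{?v (ktilde m K) | K. (\<forall>i\<in>{1..m}. K i > 0) \<and> (\<Sum>i\<in>{1..m}. K i) = a}"
  have finR: "finite ?R"
  proof (rule finite_bounded_ratios)
    fix x assume "x \<in> ?R"
    then obtain l K and G' :: "nat monoid" and B' where x: "x = real l / (real (ktilde m K) * real m)"
      and B': "BSWEDF G' B' n m K a l" and K: "(\<Sum>i\<in>{1..m}. K i) = a" by auto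
    have k: "ktilde m K \<le> fact a" using ktilde_le_fact BSWEDF_size_pos[OF B'] K by blast
    have "l \<le> ktilde m K * a * (m - 1)" using BSWEDF_upper B' assms(2) by blast
    also have "\<dots> \<le> fact a * a * (m - 1)" using k by (intro mult_le_mono) auto
    finally show "\<exists>l\<le>fact a * a * (m - 1). \<exists>k\<le>fact a. x = real l / (real k * real m)"
      using k x by blast
  qed
  have finV: "finite ?V"
  proof (rule finite_bounded_ratios)
    fix x assume "x \<in> ?V"
    then obtain K where "x = ?v (ktilde m K)" "ktilde m K \<le> fact a"
      using ktilde_le_fact by (elim CollectE exE conjE) blast
    \<comment> \<open>The value depends on \<open>K\<close> through the lcm only; \<open>l\<close>
      is a dummy parameter.\<close>
    then show "\<exists>l\<le>(0::nat). \<exists>k\<le>fact a. x = ?v k" by blast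
  qed

  have "comm_group G" "finite (carrier G)" "finite S" "card S = m"
    using assms(1) by (auto simp: weak_AMD_code_def)
  then obtain H :: "nat monoid" and f where H: "f \<in> iso G H" "comm_group H"
    using comm_group.ex_iso_nat_monoid by blast
  obtain b where b: "bij_betw b {1..m} S"
    using ex_bij_betw_nat_finite_1 \<open>finite S\<close> \<open>card S = m\<close> by blast
  define B where "B = (\<lambda>i. f ` A (b i))"
  have code: "weak_AMD_code {1..m} H B (\<lambda>i. pmf_of_set (B i)) n m a \<rho>"
    unfolding B_def using weak_AMD_code_transfer assms H b by fastforce
  then interpret finite_disjoint_family H m B
    by (auto simp: weak_AMD_code_def finite_disjoint_family_def finite_disjoint_family_axioms_def)
  obtain l where l: "BSWEDF H B (Coset.order H) m (\<lambda>i. card (B i)) tot l"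
    "Max (wins ` (carrier H - {\<one>\<^bsub>H\<^esub>})) = real l / (real kt * real m)"
    using code_imp_BSWEDF[OF assms(2)] by blast
  have "Coset.order H = n" "tot = a" "\<rho> = real l / (real kt * real m)"
    using code l(2) by (auto simp: weak_AMD_code_def)
  \<comment> \<open>The relabelled code is itself a competitor in the minimum, with ratio exactly
    \<open>\<rho>\<close>.\<close>
  with l(1) have \<rho>: "\<rho> \<in> ?R" by blast
  show "\<rho> \<ge> rho_opt n m a"
    unfolding rho_opt_def using finR \<rho> by (rule Min_le)

  \<comment> \<open>The minimum over a finite nonempty set is attained, so it suffices to bound the
    ratio of one optimal BSWEDF.\<close>
  have "rho_opt n m a \<in> ?R"
    unfolding rho_opt_def using finR \<rho> by (intro Min_in) auto
  then obtain l' K and G' :: "nat monoid" and B'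
    where r: "rho_opt n m a = real l' / (real (ktilde m K) * real m)"
      and B': "BSWEDF G' B' n m K a l'" and K: "(\<Sum>i\<in>{1..m}. K i) = a" by auto
  have Kpos: "\<forall>i\<in>{1..m}. K i > 0" using BSWEDF_size_pos[OF B'] .
  \<comment> \<open>This makes the truncated \<open>n - 1\<close> agree with
    \<open>real n - 1\<close>.\<close>
  have n: "n \<ge> 1"
    using \<open>Coset.order H = n\<close> finite_carrier
    by (metis One_nat_def Suc_leI order_gt_0_iff_finite)
  have "real (ktilde m K * a * (m - 1)) \<le> real (l' * (n - 1))"
    using BSWEDF_lower[OF B'] by (rule of_nat_mono)
  then have le: "real (ktilde m K) * real a * (real m - 1) \<le> real l' * (real n - 1)"
    using n assms(2) by (simp add: of_nat_diff)
  \<comment> \<open>For \<open>n = 1\<close> division by zero yields 0; otherwise the divisor is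
    positive.\<close>
  have "real (ktilde m K) * real a * (real m - 1) / (real n - 1) \<le> real l'"
    using le n by (cases "n = 1") (auto simp: divide_le_eq)
  \<comment> \<open>As \<open>l'\<close> is an integer, the bound survives rounding up.\<close>
  then have "\<lceil>real (ktilde m K) * real a * (real m - 1) / (real n - 1)\<rceil> \<le> int l'"
    by (simp add: ceiling_le_iff)
  then have "real_of_int \<lceil>real (ktilde m K) * real a * (real m - 1) / (real n - 1)\<rceil> \<le> real l'"
    by linarith
  then have "?v (ktilde m K) \<le> rho_opt n m a"
    unfolding r times_divide_eq_right mult_1_right by (intro divide_right_mono) auto
  moreover have "Min ?V \<le> ?v (ktilde m K)"
    using finV Kpos K by (intro Min_le) blast+
  ultimately show "rho_opt n m a \<ge> Min ?V" by linarith
qed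

end
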